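(* For every integer $n\ge 1$, $$\gamma_{rdR}(P_n\odot K_1)=\begin{cases}\left\lceil\frac{7n}{3}\right\rceil, & n\equiv 1\pmod 3,\\[2pt] \left\lceil\frac{7n}{3}\right\rceil+1, & n\equiv 0,2\pmod 3.\end{cases}$$
   Context: Graphs are finite and simple. A restrained double Roman dominating function (RDRD-function) of a graph $G$ is a function $f:V(G)\to\{0,1,2,3\}$ such that: (i) if $f(v)=0$, then $v$ has at least two neighbours assigned 2 under $f$ or at least one neighbour assigned 3; (ii) if $f(v)=1$, then $v$ has a neighbour $u$ with $f(u)\ge 2$; (iii) the subgraph of $G$ induced by the vertices assigned 0 contains no isolated vertex. The weight of $f$ is $\sum_{v\in V(G)}f(v)$, and $\gamma_{rdR}(G)$ is the minimum weight of an RDRD-function of $G$. $P_n$ is the path on $n$ vertices. The corona $G\odot K_1$ is the graph obtained from $G$ by adding, for each vertex $v\in V(G)$, a new leaf $v'$ adjacent only to $v$. *)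

theory Defs
  imports Complex_Main "Graph_Theory.Digraph_Component"
begin

text \<open>
  A finite simple graph is a symmetric loop-free digraph without parallel arcs: locale
  \<^locale>\<open>graph\<close>, or \<^locale>\<open>pair_graph\<close> when the arcs are given as pairs of vertices. The notions
  below are meant for such graphs only; symmetry is why they only look at outgoing arcs.
\<close>

definition neighbours :: "('a, 'b) pre_digraph \<Rightarrow> 'a \<Rightarrow> 'a set" where
  "neighbours G v = {u \<in> verts G. v \<rightarrow>\<^bsub>G\<^esub> u}"

definition isolated_vertex :: "('a, 'b) pre_digraph \<Rightarrow> 'a \<Rightarrow> bool" where
  "isolated_vertex G v \<longleftrightarrow> v \<in> verts G \<and> neighbours G v = {}"

text \<open>
  Labellings are functions on the whole vertex type; only their values on the vertices of the
  graph matter.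
\<close>

definition RDRD_function :: "('a, 'b) pre_digraph \<Rightarrow> ('a \<Rightarrow> nat) \<Rightarrow> bool" where
  "RDRD_function G f \<longleftrightarrow>
     f ` verts G \<subseteq> {0, 1, 2, 3} \<and>
     (\<forall>v \<in> verts G. f v = 0 \<longrightarrow>
        card {u \<in> neighbours G v. f u = 2} \<ge> 2 \<or> card {u \<in> neighbours G v. f u = 3} \<ge> 1) \<and>
     (\<forall>v \<in> verts G. f v = 1 \<longrightarrow> (\<exists>u \<in> neighbours G v. f u \<ge> 2)) \<and>
     (\<nexists>v. isolated_vertex (G \<restriction> {v \<in> verts G. f v = 0}) v)"

definition weight :: "('a, 'b) pre_digraph \<Rightarrow> ('a \<Rightarrow> nat) \<Rightarrow> nat" where
  "weight G f = (\<Sum>v \<in> verts G. f v)"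

definition gamma_rdR :: "('a, 'b) pre_digraph \<Rightarrow> nat" where
  "gamma_rdR G = (LEAST w. \<exists>f. RDRD_function G f \<and> weight G f = w)"

definition path_graph :: "nat \<Rightarrow> nat pair_pre_digraph" where
  "path_graph n = \<lparr> pverts = {1..n},
     parcs = {(i, j). i \<in> {1..n} \<and> j \<in> {1..n} \<and> (j = i + 1 \<or> i = j + 1)} \<rparr>"

text \<open>In the corona with \<open>K\<^sub>1\<close>, \<open>Inl v\<close> is the original vertex \<open>v\<close> and \<open>Inr v\<close> is its leaf \<open>v'\<close>.\<close>

definition corona_K1 :: "'a pair_pre_digraph \<Rightarrow> ('a + 'a) pair_pre_digraph" where
  "corona_K1 G = \<lparr> pverts = Inl ` pverts G \<union> Inr ` pverts G,
     parcs = {(Inl u, Inl v) | u v. (u, v) \<in> parcs G}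
           \<union> {(Inl v, Inr v) | v. v \<in> pverts G}
           \<union> {(Inr v, Inl v) | v. v \<in> pverts G} \<rparr>"

lemma pair_graph_path_graph: "pair_graph (path_graph n)"
proof -
  have "finite (parcs (path_graph n))"
    by (rule finite_subset[of _ "{1..n} \<times> {1..n}"]) (auto simp: path_graph_def)
  then show ?thesis
    by unfold_locales (auto simp: path_graph_def symmetric_def sym_def)
qed

lemma pair_graph_corona_K1:
  assumes "pair_graph G"
  shows "pair_graph (corona_K1 G)"
proof -
  interpret pair_graph G by fact
  have fin: "finite (parcs (corona_K1 G))"
    by (rule finite_subset[of _ "pverts (corona_K1 G) \<times> pverts (corona_K1 G)"])
      (auto simp: corona_K1_def dest: in_arcsD1 in_arcsD2)
  have "sym (parcs G)"
    using pair_sym_arcs by (simp add: symmetric_def)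
  then have "sym (parcs (corona_K1 G))"
    by (auto simp: corona_K1_def sym_def)
  with fin show ?thesis
    by unfold_locales
      (auto simp: corona_K1_def symmetric_def dest: in_arcsD1 in_arcsD2 pair_no_loops)
qed

lemma RDRD_function_const_2: "RDRD_function G (\<lambda>_. 2)"
  by (auto simp: RDRD_function_def isolated_vertex_def)

lemma gamma_rdR_attained: "\<exists>f. RDRD_function G f \<and> weight G f = gamma_rdR G"
  unfolding gamma_rdR_def by (rule LeastI_ex) (blast intro: RDRD_function_const_2)

lemma gamma_rdR_le: "RDRD_function G f \<Longrightarrow> gamma_rdR G \<le> weight G f"
  unfolding gamma_rdR_def by (rule Least_le) blast

end

theory Submission
  imports Defs
begin

text \<open>
  Call \<open>f (v) + f (v')\<close> the pair weight of a vertex \<open>v\<close> of the underlying graph. A leaf cannot be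
  labelled 0: its only neighbour would have to be labelled 3 to dominate it and 0 to keep it from
  being isolated among the zeros. Hence every pair weight is at least 2, and a pair weight of 2
  forces \<open>f (v') = 2\<close> and \<open>f (v) = 0\<close>. Such a light vertex needs, inside the underlying graph, one
  neighbour labelled 0 (so as not to be isolated) and another one labelled at least 2 (the leaf
  alone does not dominate it); the latter has pair weight at least 3.

  On a path this means that the two ends are not light, and that no three consecutive vertices are
  all light. So the end \<open>1\<close> contributes at least 3 and each later block of three at least 7; one vertex
  left over contributes at least 3 and two at least 2 + 3, because the last one is an end. In all three
  residue classes this gives the bound \<open>\<lfloor>(7n + 4) / 3\<rfloor>\<close>, which is the claimed value in closed form.

  The bound is attained by making vertices \<open>1, 4, 7, \<dots>\<close> heavy, with labels \<open>f (v) = 2\<close>,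
  \<open>f (v') = 1\<close>, and the two vertices between consecutive ones light. The pattern is cut off at \<open>n\<close>, where
  the last vertex is given pair weight 3 in the way that suits the residue of \<open>n\<close>.
\<close>

section \<open>Restrained double Roman domination in coronas\<close>

lemma neighbours_with_proj:
  "neighbours (with_proj G) v = {u \<in> pverts G. (v, u) \<in> parcs G}"
  by (simp add: neighbours_def arcs_ends_def arc_to_ends_def)

lemma no_isolated_zero_iff:
  "(\<nexists>v. isolated_vertex (with_proj G \<restriction> {v \<in> pverts G. f v = 0}) v) \<longleftrightarrow>
    (\<forall>v \<in> pverts G. f v = (0::nat) \<longrightarrow> (\<exists>u \<in> neighbours (with_proj G) v. f u = 0))"
  by (auto simp: isolated_vertex_def neighbours_def arcs_ends_def arc_to_ends_def
      induce_subgraph_def)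

lemma neighbours_corona_leaf:
  assumes "v \<in> pverts G"
  shows "neighbours (with_proj (corona_K1 G)) (Inr v) = {Inl v}"
  using assms by (auto simp: neighbours_with_proj corona_K1_def)

lemma neighbours_corona_base:
  assumes "v \<in> pverts G"
  shows "neighbours (with_proj (corona_K1 G)) (Inl v) =
    insert (Inr v) (Inl ` neighbours (with_proj G) v)"
  using assms by (auto simp: neighbours_with_proj corona_K1_def)

lemma weight_corona:
  assumes "finite (pverts G)"
  shows "weight (with_proj (corona_K1 G)) f = (\<Sum>v \<in> pverts G. f (Inl v) + f (Inr v))"
proof -
  have "weight (with_proj (corona_K1 G)) f =
      (\<Sum>x \<in> Inl ` pverts G. f x) + (\<Sum>x \<in> Inr ` pverts G. f x)"
    using assms by (subst sum.union_disjoint[symmetric]) (auto simp: weight_def corona_K1_def)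
  then show ?thesis
    by (simp add: sum.reindex sum.distrib)
qed

text \<open>
  The base vertex is the only neighbour of its leaf, so both domination and restraint of a leaf
  fall on it alone. For a leaf labelled 0 they ask for the labels 3 and 0 at once: two neighbours
  labelled 2 are not available.
\<close>

lemma RDRD_corona_leaf:
  assumes "RDRD_function (with_proj (corona_K1 G)) f" and v: "v \<in> pverts G"
  shows "f (Inr v) \<ge> 1" and "f (Inr v) = 1 \<Longrightarrow> f (Inl v) \<ge> 2"
proof -
  have leaf: "Inr v \<in> pverts (corona_K1 G)"
    using v by (simp add: corona_K1_def)
  have zero: "f (Inl v) = 0" if "f (Inr v) = 0"
    using assms(1) leaf that no_isolated_zero_iff[of "corona_K1 G" f]
    by (auto simp: RDRD_function_def neighbours_corona_leaf[OF v])
  have "card {u. u = Inl v \<and> f u = 2} \<le> 1"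
    using card_mono[of "{Inl v}" "{u. u = Inl v \<and> f u = 2}"] by auto
  moreover have "f (Inl v) = 3" if "card {u. u = Inl v \<and> f u = 3} \<ge> 1"
  proof (rule ccontr)
    assume "f (Inl v) \<noteq> 3"
    then have "{u. u = Inl v \<and> f u = 3} = {}" by auto
    with that show False by simp
  qed
  ultimately have "f (Inl v) = 3" if "f (Inr v) = 0"
    using assms(1) leaf that by (force simp: RDRD_function_def neighbours_corona_leaf[OF v])
  with zero show "f (Inr v) \<ge> 1" by fastforce
  show "f (Inl v) \<ge> 2" if "f (Inr v) = 1"
    using assms(1) leaf that by (auto simp: RDRD_function_def neighbours_corona_leaf[OF v])
qed

lemma RDRD_corona_pair_ge_2:
  assumes "RDRD_function (with_proj (corona_K1 G)) f" and "v \<in> pverts G"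
  shows "f (Inl v) + f (Inr v) \<ge> 2"
  using RDRD_corona_leaf[OF assms] by linarith

text \<open>
  A pair weight below 3 leaves only the labels 0 on the base and 2 on the leaf. The leaf is then
  neither a neighbour labelled 0 nor enough to dominate the base, so both must come from the
  underlying graph. The neighbours obtained are distinct, as their labels differ.
\<close>

lemma RDRD_corona_light:
  assumes f: "RDRD_function (with_proj (corona_K1 G)) f" and v: "v \<in> pverts G"
    and light: "f (Inl v) + f (Inr v) < 3"
  obtains x y where "x \<in> neighbours (with_proj G) v" "f (Inl x) = 0"
    and "y \<in> neighbours (with_proj G) v" "f (Inl y) \<ge> 2"
proof -
  let ?N = "neighbours (with_proj (corona_K1 G)) (Inl v)"
  have base: "Inl v \<in> pverts (corona_K1 G)"
    using v by (simp add: corona_K1_def)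
  have labels: "f (Inl v) = 0" "f (Inr v) = 2"
    using RDRD_corona_leaf[OF f v] light by linarith+
  have "\<exists>u \<in> ?N. f u = 0"
    using f base labels no_isolated_zero_iff[of "corona_K1 G" f] by (auto simp: RDRD_function_def)
  then obtain x where x: "x \<in> neighbours (with_proj G) v" "f (Inl x) = 0"
    using labels by (auto simp: neighbours_corona_base[OF v])
  have "\<exists>u \<in> ?N. u \<noteq> Inr v \<and> f u \<ge> 2"
  proof (rule ccontr)
    assume "\<not> ?thesis"
    then have only: "{u \<in> ?N. f u = 2} \<subseteq> {Inr v}" and no3: "{u \<in> ?N. f u = 3} = {}"
      using labels by force+
    have "card {u \<in> ?N. f u = 2} \<le> 1"
      using card_mono[OF _ only] by simp
    moreover have "card {u \<in> ?N. f u = 2} \<ge> 2 \<or> card {u \<in> ?N. f u = 3} \<ge> 1"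
      using f base labels by (simp add: RDRD_function_def)
    ultimately show False
      by (simp add: no3)
  qed
  then obtain y where "y \<in> neighbours (with_proj G) v" "f (Inl y) \<ge> 2"
    by (auto simp: neighbours_corona_base[OF v])
  with x show thesis by (rule that)
qed

section \<open>The lower bound on paths\<close>

lemma pverts_path_graph: "pverts (path_graph n) = {1..n}"
  by (simp add: path_graph_def)

lemma neighbours_path:
  assumes "i \<in> {1..n}"
  shows "neighbours (with_proj (path_graph n)) i = {j \<in> {1..n}. j = i + 1 \<or> i = j + 1}"
  using assms by (auto simp: neighbours_with_proj path_graph_def)

text \<open>
  The end \<open>1\<close> is kept apart and the remaining vertices are cut into consecutive triples; for
  \<open>n \<equiv> 1 (mod 3)\<close> they cover the whole path, otherwise one or two vertices remain.
\<close>

lemma sum_ge_of_triples: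
  fixes w :: "nat \<Rightarrow> nat"
  assumes first: "w 1 \<ge> 3"
    and triple: "\<And>i. 1 \<le> i \<Longrightarrow> i + 2 \<le> n \<Longrightarrow> w i + w (i + 1) + w (i + 2) \<ge> 7"
    and "3 * k + 1 \<le> n"
  shows "(\<Sum>i = 1..3 * k + 1. w i) \<ge> 7 * k + 3"
  using assms(3)
proof (induction k)
  case 0
  then show ?case using first by simp
next
  case (Suc k)
  have "(\<Sum>i = 1..3 * Suc k + 1. w i) =
      (\<Sum>i = 1..3 * k + 1. w i) + (w (3 * k + 2) + w (3 * k + 2 + 1) + w (3 * k + 2 + 2))"
    by (simp add: numeral_eq_Suc)
  moreover have "w (3 * k + 2) + w (3 * k + 2 + 1) + w (3 * k + 2 + 2) \<ge> 7"
    using Suc.prems by (intro triple) auto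
  ultimately show ?case using Suc by simp
qed

lemma sum_ge_of_triples_and_ends:
  fixes w :: "nat \<Rightarrow> nat"
  assumes "n \<ge> 1" and first: "w 1 \<ge> 3" and last: "w n \<ge> 3"
    and pos: "\<And>i. 1 \<le> i \<Longrightarrow> i \<le> n \<Longrightarrow> w i \<ge> 2"
    and triple: "\<And>i. 1 \<le> i \<Longrightarrow> i + 2 \<le> n \<Longrightarrow> w i + w (i + 1) + w (i + 2) \<ge> 7"
  shows "(\<Sum>i = 1..n. w i) \<ge> (7 * n + 4) div 3"
proof -
  define k where "k = (n - 1) div 3"
  have prefix: "(\<Sum>i = 1..3 * k + 1. w i) \<ge> 7 * k + 3"
    using \<open>n \<ge> 1\<close> by (intro sum_ge_of_triples[OF first triple]) (auto simp: k_def)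
  consider "n = 3 * k + 1" | "n = 3 * k + 2" | "n = 3 * k + 3"
    using \<open>n \<ge> 1\<close> unfolding k_def by linarith
  then show ?thesis
  proof cases
    case 1
    with prefix show ?thesis by simp
  next
    case 2
    have "(\<Sum>i = 1..n. w i) = (\<Sum>i = 1..3 * k + 1. w i) + w n"
      unfolding 2 by simp
    with prefix last 2 show ?thesis by linarith
  next
    case 3
    have "(\<Sum>i = 1..n. w i) = (\<Sum>i = 1..3 * k + 1. w i) + w (3 * k + 2) + w n"
      unfolding 3 by (simp add: numeral_eq_Suc)
    moreover have "w (3 * k + 2) \<ge> 2"
      using 3 by (intro pos) auto
    ultimately show ?thesis using prefix last 3 by linarith
  qed
qed

lemma weight_RDRD_corona_path_ge:
  assumes "n \<ge> 1" and f: "RDRD_function (with_proj (corona_K1 (path_graph n))) f"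
  shows "weight (with_proj (corona_K1 (path_graph n))) f \<ge> (7 * n + 4) div 3"
proof -
  define w where "w i = f (Inl i) + f (Inr i)" for i
  have ge2: "w i \<ge> 2" if "i \<in> {1..n}" for i
    using RDRD_corona_pair_ge_2[OF f] that by (simp add: w_def pverts_path_graph)
  have light: "\<exists>x y. x \<noteq> y \<and> w y \<ge> 3 \<and> {x, y} \<subseteq> {j \<in> {1..n}. j = i + 1 \<or> i = j + 1}"
    if i: "i \<in> {1..n}" and less: "w i < 3" for i
  proof -
    obtain x y where xy: "x \<in> neighbours (with_proj (path_graph n)) i" "f (Inl x) = 0"
        "y \<in> neighbours (with_proj (path_graph n)) i" "f (Inl y) \<ge> 2"
      using RDRD_corona_light[OF f, of i] i less by (auto simp: w_def pverts_path_graph)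
    then have "y \<in> {1..n}"
      using i by (simp add: neighbours_path)
    then have "w y \<ge> 3"
      using RDRD_corona_leaf(1)[OF f, of y] xy(4) by (simp add: w_def pverts_path_graph)
    moreover have "x \<noteq> y"
      using xy by auto
    ultimately show ?thesis
      using xy by (auto simp: neighbours_path[OF i])
  qed
  have "(\<Sum>i = 1..n. w i) \<ge> (7 * n + 4) div 3"
  proof (rule sum_ge_of_triples_and_ends)
    \<comment> \<open>A light vertex has two distinct neighbours, which an end does not.\<close>
    show "w 1 \<ge> 3"
      using light[of 1] \<open>n \<ge> 1\<close> by (fastforce simp: not_less[symmetric])
    show "w n \<ge> 3"
      using light[of n] \<open>n \<ge> 1\<close> by (fastforce simp: not_less[symmetric])
    show "w i + w (i + 1) + w (i + 2) \<ge> 7" if "1 \<le> i" "i + 2 \<le> n" for i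
    proof -
      have "w i \<ge> 3 \<or> w (i + 1) \<ge> 3 \<or> w (i + 2) \<ge> 3"
        using light[of "i + 1"] that by (fastforce simp: not_less[symmetric])
      then show ?thesis
        using ge2[of i] ge2[of "i + 1"] ge2[of "i + 2"] that by auto
    qed
  qed (use \<open>n \<ge> 1\<close> ge2 in auto)
  then show ?thesis
    by (simp add: weight_corona pverts_path_graph w_def)
qed

section \<open>A labelling of minimum weight\<close>

text \<open>
  Both exceptions concern the last vertex. If \<open>n \<equiv> 2 (mod 3)\<close> the pattern would label it 0
  without a neighbour labelled 0, so it is made heavy. If \<open>n \<equiv> 0 (mod 3)\<close> it has a neighbour
  labelled 0 but no heavy one; raising its leaf to 3 dominates it.
\<close>

fun optimal_labelling :: "nat \<Rightarrow> nat + nat \<Rightarrow> nat" where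
  "optimal_labelling n (Inl i) = (if i mod 3 = 1 \<or> i = n \<and> n mod 3 = 2 then 2 else 0)"
| "optimal_labelling n (Inr i) =
    (if i mod 3 = 1 \<or> i = n \<and> n mod 3 = 2 then 1 else if i = n then 3 else 2)"

lemma RDRD_optimal_labelling:
  "RDRD_function (with_proj (corona_K1 (path_graph n))) (optimal_labelling n)"
  (is "RDRD_function ?G ?f")
proof -
  have leaf_nbrs: "neighbours ?G (Inr i) = {Inl i}" if "i \<in> {1..n}" for i
    using that by (simp add: neighbours_corona_leaf pverts_path_graph)
  have base_nbrs: "neighbours ?G (Inl i) =
      insert (Inr i) (Inl ` {j \<in> {1..n}. j = i + 1 \<or> i = j + 1})" if "i \<in> {1..n}" for i
    using that by (simp add: neighbours_corona_base pverts_path_graph neighbours_path)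
  have verts: "v \<in> pverts (corona_K1 (path_graph n)) \<longleftrightarrow> (\<exists>i \<in> {1..n}. v = Inl i \<or> v = Inr i)" for v
    by (auto simp: corona_K1_def pverts_path_graph)
  have finite_nbrs: "finite (neighbours ?G v)" if "v \<in> pverts (corona_K1 (path_graph n))" for v
    using that by (auto simp: verts leaf_nbrs base_nbrs)
  \<comment> \<open>The zeros come in adjacent pairs \<open>3q + 2, 3q + 3\<close>; the heavy vertices
    next to such a pair are \<open>3q + 1\<close> and, unless the path ends before it, \<open>3q + 4\<close>.\<close>
  have labels: "?f (Inl (3 * q + 1)) = 2" "?f (Inl (3 * q + 4)) = 2" for q
    by (simp_all add: mod_Suc)
  have labels_pair: "?f (Inl (3 * q + 2)) = 0" "?f (Inr (3 * q + 2)) = 2" "?f (Inl (3 * q + 3)) = 0"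
      "?f (Inr (3 * q + 3)) = (if n = 3 * q + 3 then 3 else 2)"
    if "3 * q + 3 \<le> n" for q
    using that by (auto simp: mod_Suc)
  have zero: "\<exists>q. 3 * q + 3 \<le> n \<and> (v = Inl (3 * q + 2) \<or> v = Inl (3 * q + 3))"
    if "v \<in> pverts (corona_K1 (path_graph n))" "?f v = 0" for v
  proof -
    from that obtain i where i: "i \<in> {1..n}" "v = Inl i" "i mod 3 \<noteq> 1"
        "\<not> (i = n \<and> i mod 3 = 2)"
      by (auto simp: verts split: if_splits)
    define q where "q = (i - 1) div 3"
    have "i = 3 * q + 1 \<or> i = 3 * q + 2 \<or> i = 3 * q + 3"
      using i(1) unfolding q_def atLeastAtMost_iff by linarith
    moreover have "i \<noteq> 3 * q + 1"
      using i(3) by auto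
    moreover have "i \<noteq> n" if "i = 3 * q + 2"
      using i(4) that by (auto simp: mod_Suc)
    ultimately have "3 * q + 3 \<le> n \<and> (i = 3 * q + 2 \<or> i = 3 * q + 3)"
      using i(1) unfolding atLeastAtMost_iff by linarith
    with i(2) show ?thesis by blast
  qed
  have dominated: "card {u \<in> neighbours ?G v. ?f u = 2} \<ge> 2 \<or>
      card {u \<in> neighbours ?G v. ?f u = 3} \<ge> 1"
    if v: "v \<in> pverts (corona_K1 (path_graph n))" "?f v = 0" for v
  proof -
    have two: "card {u \<in> neighbours ?G v. ?f u = 2} \<ge> 2"
      if "Inr i \<in> neighbours ?G v" "?f (Inr i) = 2" "Inl j \<in> neighbours ?G v" "?f (Inl j) = 2" for i j
    proof -
      have "{Inr i, Inl j} \<subseteq> {u \<in> neighbours ?G v. ?f u = 2}"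
        using that by blast
      then have "card {Inr i, Inl j :: nat + nat} \<le> card {u \<in> neighbours ?G v. ?f u = 2}"
        using finite_nbrs[OF v(1)] by (intro card_mono) auto
      then show ?thesis by simp
    qed
    obtain q where q: "3 * q + 3 \<le> n" and "v = Inl (3 * q + 2) \<or> v = Inl (3 * q + 3)"
      using zero[OF v] by auto
    then consider "v = Inl (3 * q + 2)" | "v = Inl (3 * q + 3)" "n = 3 * q + 3"
      | "v = Inl (3 * q + 3)" "3 * q + 4 \<le> n"
      by linarith
    then show ?thesis
    proof cases
      case 1
      then have "Inr (3 * q + 2) \<in> neighbours ?G v" "Inl (3 * q + 1) \<in> neighbours ?G v"
        using q by (auto simp: base_nbrs)
      then show ?thesis
        using two labels(1) labels_pair(2)[OF q] by blast
    next
      case 2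
      have "Inr (3 * q + 3) \<in> neighbours ?G v"
        using q 2(1) by (auto simp: base_nbrs)
      moreover have "?f (Inr (3 * q + 3)) = 3"
        unfolding labels_pair(4)[OF q] using 2 by simp
      ultimately have "{u \<in> neighbours ?G v. ?f u = 3} \<noteq> {}"
        by blast
      then have "card {u \<in> neighbours ?G v. ?f u = 3} > 0"
        using finite_nbrs[OF v(1)] by (simp only: card_gt_0_iff) simp
      then show ?thesis by linarith
    next
      case 3
      then have "Inr (3 * q + 3) \<in> neighbours ?G v" "Inl (3 * q + 4) \<in> neighbours ?G v"
        using q by (auto simp: base_nbrs)
      moreover have "?f (Inr (3 * q + 3)) = 2"
        unfolding labels_pair(4)[OF q] using 3 by simp
      ultimately show ?thesis
        using two labels(2) by blast
    qed
  qed
  have one: "\<exists>u \<in> neighbours ?G v. ?f u \<ge> 2"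
    if v: "v \<in> pverts (corona_K1 (path_graph n))" "?f v = 1" for v
  proof -
    have "?f (Inl i) \<noteq> 1" for i
      by simp
    with v obtain i where i: "i \<in> {1..n}" "v = Inr i"
      unfolding verts by metis
    have "?f (Inl i) = 2"
      using v(2) unfolding i(2) optimal_labelling.simps by presburger
    with i show ?thesis
      by (simp only: leaf_nbrs) simp
  qed
  have restrained: "\<exists>u \<in> neighbours ?G v. ?f u = 0"
    if v: "v \<in> pverts (corona_K1 (path_graph n))" "?f v = 0" for v
  proof -
    obtain q where q: "3 * q + 3 \<le> n" and "v = Inl (3 * q + 2) \<or> v = Inl (3 * q + 3)"
      using zero[OF v] by auto
    then have "Inl (3 * q + 3) \<in> neighbours ?G v \<or> Inl (3 * q + 2) \<in> neighbours ?G v"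
      by (auto simp: base_nbrs)
    then show ?thesis
      using labels_pair(1,3)[OF q] by blast
  qed
  have "?f v \<in> {0, 1, 2, 3}" for v
    by (cases v) auto
  then have range: "?f ` verts ?G \<subseteq> {0, 1, 2, 3}"
    by (rule image_subsetI)
  show ?thesis
    unfolding RDRD_function_def with_proj_simps(1) no_isolated_zero_iff
    using range[unfolded with_proj_simps(1)] dominated one restrained by blast
qed

lemma sum_period_3: "(\<Sum>i = 1..m. if i mod 3 = 1 then 3 else 2) = (7 * m + 2) div (3::nat)"
  by (induction m) (simp, simp, presburger)

lemma weight_optimal_labelling:
  assumes "n \<ge> 1"
  shows "weight (with_proj (corona_K1 (path_graph n))) (optimal_labelling n) = (7 * n + 4) div 3"
proof -
  obtain m where n: "n = Suc m"
    using assms by (cases n) auto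
  let ?w = "\<lambda>i. optimal_labelling n (Inl i) + optimal_labelling n (Inr i)"
  have "(\<Sum>i = 1..m. ?w i) = (\<Sum>i = 1..m. if i mod 3 = 1 then 3 else 2)"
    by (intro sum.cong) (auto simp: n)
  moreover have "?w n = 3"
    by simp
  ultimately have "(\<Sum>i = 1..n. ?w i) = (7 * m + 2) div 3 + 3"
    unfolding sum_period_3 by (simp add: n)
  then show ?thesis
    by (simp add: weight_corona pverts_path_graph n)
qed

section \<open>The value for paths\<close>

lemma gamma_rdR_corona_path:
  assumes "n \<ge> 1"
  shows "gamma_rdR (with_proj (corona_K1 (path_graph n))) = (7 * n + 4) div 3"
proof (rule antisym)
  show "gamma_rdR (with_proj (corona_K1 (path_graph n))) \<le> (7 * n + 4) div 3"
    using gamma_rdR_le[OF RDRD_optimal_labelling] weight_optimal_labelling[OF assms] by metis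
  show "gamma_rdR (with_proj (corona_K1 (path_graph n))) \<ge> (7 * n + 4) div 3"
    using gamma_rdR_attained weight_RDRD_corona_path_ge[OF assms] by metis
qed

theorem theorem5p7:
  fixes n :: nat
  assumes "n \<ge> 1"
  shows "int (gamma_rdR (with_proj (corona_K1 (path_graph n)))) =
    (if n mod 3 = 1 then \<lceil>7 * real n / 3\<rceil> else \<lceil>7 * real n / 3\<rceil> + 1)"
proof -
  have "\<lceil>7 * real n / 3\<rceil> = (7 * int n + 2) div 3"
    by linarith
  moreover have "int ((7 * n + 4) div 3) =
      (if n mod 3 = 1 then (7 * int n + 2) div 3 else (7 * int n + 2) div 3 + 1)"
    by presburger
  ultimately show ?thesis
    unfolding gamma_rdR_corona_path[OF assms] by simp
qed

end
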